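(* Let $B\subset X$ be a ball such that $X\setminus\overline{B}$ is nonempty. For every $E\subset B$ we have $$\mathrm{cap}_1(E,B)\approx\mathrm{Cap}_1(E,B)$$ with the constants of comparison depending solely on the doubling constant, the Poincaré constants, and the ball $B$.
   Context: Notation: $a\approx b$ means that there is a constant $C\ge1$ (the constant of comparison) with $C^{-1}a\le b\le Ca$. Standing assumptions: $X=(X,d,\mu)$ is a complete metric space with a Borel regular outer measure $\mu$, $0<\mu(B)<\infty$ for all balls $B$, which is doubling: there is a constant $C_D$ (the doubling constant) with $\mu(2B)\le C_D\mu(B)$ for all balls $B$. Moreover $X$ supports a weak $(1,1)$-Poincaré inequality: there are constants $C_P>0$, $\tau\ge 1$ (the Poincaré constants) such that for all balls $B(x,r)$, all locally integrable $u$ on $X$ and all $1$-weak upper gradients $g$ of $u$, $$\frac{1}{\mu(B(x,r))}\int_{B(x,r)}|u-u_{B(x,r)}|\,d\mu\le C_P\,r\,\frac{1}{\mu(B(x,\tau r))}\int_{B(x,\tau r)}g\,d\mu,$$ where $u_{B(x,r)}=\frac{1}{\mu(B(x,r))}\int_{B(x,r)}u\,d\mu$. Balls are open. Paths and upper gradients: A path is a rectifiable nonconstant continuous mapping from a compact interval to $X$. A nonnegative Borel function $g$ on an open set $\Omega$ is an upper gradient of an extended real valued function $u$ on $\Omega$ if for all paths $\gamma$ in $\Omega$ with endpoints $x,y$: $|u(x)-u(y)|\le\int_\gamma g\,ds$ whenever $u(x),u(y)$ are both finite, and $\int_\gamma g\,ds=\infty$ otherwise. The $1$-modulus of a collection $\Gamma$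 of paths in $\Omega$ is $\inf_\varrho\int_\Omega\varrho\,d\mu$, over all nonnegative Borel $\varrho$ with $\int_\gamma\varrho\,ds\ge1$ for every $\gamma\in\Gamma$. A nonnegative measurable $g$ is a $1$-weak upper gradient of $u$ if the upper gradient inequality holds (with $\int_\gamma g\,ds$ well defined) for all paths outside a family of zero $1$-modulus. Function space: for $\Omega\subset X$ open, $N^{1,1}(\Omega)$ consists of the (pointwise defined) $u\in L^1(\Omega)$ with $\|u\|_{N^{1,1}(\Omega)}=\int_\Omega|u|\,d\mu+\inf_g\int_\Omega g\,d\mu<\infty$, the infimum over $1$-weak upper gradients $g$ of $u$ (functions identified when the norm of their difference is $0$). Capacities: for a ball $B\subset X$ and $E\subset B$, $$\mathrm{cap}_1(E,B)=\inf\int_Bg_u\,d\mu,\qquad \mathrm{Cap}_1(E,B)=\inf\int_B(|u|+g_u)\,d\mu,$$ both infima over all $u\in N^{1,1}(B)$ and all upper gradients $g_u$ of $u$ such that $u=1$ on $E$ and $u$ has compact support in $B$; the infimum is $\infty$ if there are no such functions. *)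

theory Defs
  imports "HOL-Analysis.Analysis"
begin

definition borel_regular_outer_measure :: "('a::topological_space set \<Rightarrow> ennreal) \<Rightarrow> bool" where
  "borel_regular_outer_measure \<mu> \<longleftrightarrow>
     outer_measure_space (Pow UNIV) \<mu> \<and>
     sets borel \<subseteq> lambda_system UNIV (Pow UNIV) \<mu> \<and>
     (\<forall>A. \<exists>B \<in> sets borel. A \<subseteq> B \<and> \<mu> B = \<mu> A)"

text \<open>The measure space of the Caratheodory measurable sets of an outer measure. Integrals, and
  measurability with respect to the outer measure, refer to this space.\<close>

definition caratheodory :: "('a set \<Rightarrow> ennreal) \<Rightarrow> 'a measure" where
  "caratheodory \<mu> = measure_of UNIV (lambda_system UNIV (Pow UNIV) \<mu>) \<mu>"

definition doubling :: "real \<Rightarrow> ('a::metric_space set \<Rightarrow> ennreal) \<Rightarrow> bool" where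
  "doubling C\<^sub>D \<mu> \<longleftrightarrow>
     (\<forall>x r. 0 < r \<longrightarrow> 0 < \<mu> (ball x r) \<and> \<mu> (ball x r) < \<infinity> \<and>
        \<mu> (ball x (2 * r)) \<le> ennreal C\<^sub>D * \<mu> (ball x r))"

text \<open>A curve is a triple \<open>(a, b, \<gamma>)\<close>; only the values of \<open>\<gamma>\<close> on \<open>{a..b}\<close> matter.\<close>

type_synonym 'a curve = "real \<times> real \<times> (real \<Rightarrow> 'a)"

definition curve_length :: "(real \<Rightarrow> 'a::metric_space) \<Rightarrow> real \<Rightarrow> real \<Rightarrow> ennreal" where
  "curve_length \<gamma> a b =
     (SUP (n, t) \<in> {(n::nat, t::nat \<Rightarrow> real). mono_on {..n} t \<and> t 0 = a \<and> t n = b}.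
        \<Sum>i<n. ennreal (dist (\<gamma> (t i)) (\<gamma> (t (Suc i)))))"

definition paths_in :: "'a::metric_space set \<Rightarrow> 'a curve set" where
  "paths_in \<Omega> = {(a, b, \<gamma>). a \<le> b \<and> continuous_on {a..b} \<gamma> \<and> curve_length \<gamma> a b < \<infinity> \<and>
      \<not> \<gamma> constant_on {a..b} \<and> \<gamma> ` {a..b} \<subseteq> \<Omega>}"

text \<open>The arc-length parametrization \<open>[0, l] \<rightarrow> X\<close> of a rectifiable curve of length \<open>l\<close>. The choice of
  the parameter \<open>t\<close> is immaterial: \<open>\<gamma>\<close> is constant on an interval over which its length does not grow.\<close>

definition arc_length_param :: "'a::metric_space curve \<Rightarrow> real \<Rightarrow> 'a" where
  "arc_length_param = (\<lambda>(a, b, \<gamma>) s. \<gamma> (SOME t. t \<in> {a..b} \<and> curve_length \<gamma> a t = ennreal s))"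

definition arc_interval :: "'a::metric_space curve \<Rightarrow> real set" where
  "arc_interval = (\<lambda>(a, b, \<gamma>). {0..enn2real (curve_length \<gamma> a b)})"

definition curve_integral :: "('a::metric_space \<Rightarrow> ennreal) \<Rightarrow> 'a curve \<Rightarrow> ennreal" where
  "curve_integral g p = (\<integral>\<^sup>+ s \<in> arc_interval p. g (arc_length_param p s) \<partial>lebesgue)"

definition curve_integral_well_defined :: "('a::metric_space \<Rightarrow> ennreal) \<Rightarrow> 'a curve \<Rightarrow> bool" where
  "curve_integral_well_defined g p \<longleftrightarrow>
     (\<lambda>s. g (arc_length_param p s)) \<in> borel_measurable (lebesgue_on (arc_interval p))"

definition ug_inequality :: "('a::metric_space \<Rightarrow> ereal) \<Rightarrow> ('a \<Rightarrow> ennreal) \<Rightarrow> 'a curve \<Rightarrow> bool" where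
  "ug_inequality u g = (\<lambda>(a, b, \<gamma>).
     if \<bar>u (\<gamma> a)\<bar> \<noteq> \<infinity> \<and> \<bar>u (\<gamma> b)\<bar> \<noteq> \<infinity>
     then e2ennreal \<bar>u (\<gamma> a) - u (\<gamma> b)\<bar> \<le> curve_integral g (a, b, \<gamma>)
     else curve_integral g (a, b, \<gamma>) = \<infinity>)"

text \<open>Functions on an open set \<open>\<Omega>\<close> are represented by total functions; their values outside \<open>\<Omega>\<close> are
  never used.\<close>

definition upper_gradient :: "'a::metric_space set \<Rightarrow> ('a \<Rightarrow> ereal) \<Rightarrow> ('a \<Rightarrow> ennreal) \<Rightarrow> bool" where
  "upper_gradient \<Omega> u g \<longleftrightarrow>
     g \<in> borel_measurable (restrict_space borel \<Omega>) \<and> (\<forall>p \<in> paths_in \<Omega>. ug_inequality u g p)"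

definition modulus1 :: "('a::metric_space set \<Rightarrow> ennreal) \<Rightarrow> 'a set \<Rightarrow> 'a curve set \<Rightarrow> ennreal" where
  "modulus1 \<mu> \<Omega> \<Gamma> =
     (INF \<rho> \<in> {\<rho>. \<rho> \<in> borel_measurable (restrict_space borel \<Omega>) \<and>
                   (\<forall>p \<in> \<Gamma>. 1 \<le> curve_integral \<rho> p)}.
        \<integral>\<^sup>+ x \<in> \<Omega>. \<rho> x \<partial>caratheodory \<mu>)"

definition weak_upper_gradient1 ::
    "('a::metric_space set \<Rightarrow> ennreal) \<Rightarrow> 'a set \<Rightarrow> ('a \<Rightarrow> ereal) \<Rightarrow> ('a \<Rightarrow> ennreal) \<Rightarrow> bool" where
  "weak_upper_gradient1 \<mu> \<Omega> u g \<longleftrightarrow>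
     g \<in> borel_measurable (restrict_space (caratheodory \<mu>) \<Omega>) \<and>
     (\<exists>\<Gamma> \<subseteq> paths_in \<Omega>. modulus1 \<mu> \<Omega> \<Gamma> = 0 \<and>
        (\<forall>p \<in> paths_in \<Omega> - \<Gamma>. curve_integral_well_defined g p \<and> ug_inequality u g p))"

definition N11_norm :: "('a::metric_space set \<Rightarrow> ennreal) \<Rightarrow> 'a set \<Rightarrow> ('a \<Rightarrow> ereal) \<Rightarrow> ennreal" where
  "N11_norm \<mu> \<Omega> u =
     (\<integral>\<^sup>+ x \<in> \<Omega>. e2ennreal \<bar>u x\<bar> \<partial>caratheodory \<mu>) +
     (INF g \<in> {g. weak_upper_gradient1 \<mu> \<Omega> u g}. \<integral>\<^sup>+ x \<in> \<Omega>. g x \<partial>caratheodory \<mu>)"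

text \<open>The pointwise defined representatives; finiteness of the norm includes integrability.\<close>

definition N11 :: "('a::metric_space set \<Rightarrow> ennreal) \<Rightarrow> 'a set \<Rightarrow> ('a \<Rightarrow> ereal) set" where
  "N11 \<mu> \<Omega> = {u. u \<in> borel_measurable (restrict_space (caratheodory \<mu>) \<Omega>) \<and> N11_norm \<mu> \<Omega> u < \<infinity>}"

definition locally_integrable :: "('a::metric_space set \<Rightarrow> ennreal) \<Rightarrow> ('a \<Rightarrow> ereal) \<Rightarrow> bool" where
  "locally_integrable \<mu> u \<longleftrightarrow>
     u \<in> borel_measurable (caratheodory \<mu>) \<and>
     (\<forall>x. \<exists>r>0. (\<integral>\<^sup>+ y \<in> ball x r. e2ennreal \<bar>u y\<bar> \<partial>caratheodory \<mu>) < \<infinity>)"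

text \<open>An integrable function is finite almost everywhere, so \<open>real_of_ereal\<close> does not affect the mean.\<close>

definition mean_value :: "('a set \<Rightarrow> ennreal) \<Rightarrow> 'a set \<Rightarrow> ('a \<Rightarrow> ereal) \<Rightarrow> real" where
  "mean_value \<mu> A u = (LINT x:A|caratheodory \<mu>. real_of_ereal (u x)) / enn2real (\<mu> A)"

definition weak_poincare11 :: "real \<Rightarrow> real \<Rightarrow> ('a::metric_space set \<Rightarrow> ennreal) \<Rightarrow> bool" where
  "weak_poincare11 C\<^sub>P \<tau> \<mu> \<longleftrightarrow>
     (\<forall>x r u g. 0 < r \<longrightarrow> locally_integrable \<mu> u \<longrightarrow> weak_upper_gradient1 \<mu> UNIV u g \<longrightarrow>
        (\<integral>\<^sup>+ y \<in> ball x r. e2ennreal \<bar>u y - ereal (mean_value \<mu> (ball x r) u)\<bar> \<partial>caratheodory \<mu>)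
          / \<mu> (ball x r)
        \<le> ennreal (C\<^sub>P * r) *
            ((\<integral>\<^sup>+ y \<in> ball x (\<tau> * r). g y \<partial>caratheodory \<mu>) / \<mu> (ball x (\<tau> * r))))"

text \<open>The pairs \<open>(u, g\<^sub>u)\<close> admissible for both capacities. Having compact support in \<open>B\<close> is
  expressed through the closure in the whole space.\<close>

definition admissible ::
    "('a::metric_space set \<Rightarrow> ennreal) \<Rightarrow> 'a set \<Rightarrow> 'a set \<Rightarrow> (('a \<Rightarrow> ereal) \<times> ('a \<Rightarrow> ennreal)) set" where
  "admissible \<mu> E B = {(u, g). u \<in> N11 \<mu> B \<and> upper_gradient B u g \<and> (\<forall>x\<in>E. u x = 1) \<and>
      compact (closure {x \<in> B. u x \<noteq> 0}) \<and> closure {x \<in> B. u x \<noteq> 0} \<subseteq> B}"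

definition var_cap1 :: "('a::metric_space set \<Rightarrow> ennreal) \<Rightarrow> 'a set \<Rightarrow> 'a set \<Rightarrow> ennreal" where
  "var_cap1 \<mu> E B = (INF (u, g) \<in> admissible \<mu> E B. \<integral>\<^sup>+ x \<in> B. g x \<partial>caratheodory \<mu>)"

definition Sobolev_cap1 :: "('a::metric_space set \<Rightarrow> ennreal) \<Rightarrow> 'a set \<Rightarrow> 'a set \<Rightarrow> ennreal" where
  "Sobolev_cap1 \<mu> E B =
     (INF (u, g) \<in> admissible \<mu> E B. \<integral>\<^sup>+ x \<in> B. (e2ennreal \<bar>u x\<bar> + g x) \<partial>caratheodory \<mu>)"

definition comparable :: "real \<Rightarrow> ennreal \<Rightarrow> ennreal \<Rightarrow> bool" where
  "comparable C a b \<longleftrightarrow> ennreal (1 / C) * a \<le> b \<and> b \<le> ennreal C * a"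

end

theory Submission
  imports Defs
begin

text \<open>A function \<open>u\<close> that is admissible for the capacities, extended by zero outside the ball \<open>B\<close>, has the
  zero extension of \<open>g\<^sub>u\<close> as an upper gradient on the whole space: on a path that leaves \<open>B\<close>, the part
  before the first exit and the part after the last entry each pass through a point of \<open>B\<close> outside the
  support of \<open>u\<close>. Since \<open>u\<close> vanishes on a ball \<open>D\<close> disjoint from \<open>B\<close>, the Poincare inequality on a ball
  \<open>B'\<close> containing \<open>B\<close> and \<open>D\<close> bounds \<open>\<mu> D\<close> times the mean of \<open>u\<close> over \<open>B'\<close>, and doubling compares
  \<open>\<mu> B'\<close> with \<open>\<mu> D\<close>. This yields \<open>\<integral>\<^sub>B \<bar>u\<bar> \<le> K \<integral>\<^sub>B g\<^sub>u\<close> with \<open>K\<close> depending on the data only.\<close>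

section \<open>Length of curves\<close>

lemma partition_sum_le_curve_length:
  assumes "mono_on {..n} t" "t 0 = a" "t n = b"
  shows "(\<Sum>i<n. ennreal (dist (\<gamma> (t i)) (\<gamma> (t (Suc i))))) \<le> curve_length \<gamma> a b"
proof -
  have "(n, t) \<in> {(n, t). mono_on {..n} t \<and> t 0 = a \<and> t n = b}"
    using assms by simp
  from SUP_upper[OF this, of "\<lambda>(n, t). \<Sum>i<n. ennreal (dist (\<gamma> (t i)) (\<gamma> (t (Suc i))))"]
  show ?thesis by (simp add: curve_length_def)
qed

lemma curve_length_leI:
  assumes "\<And>n t. mono_on {..n} t \<Longrightarrow> t 0 = a \<Longrightarrow> t n = b \<Longrightarrow>
    (\<Sum>i<n. ennreal (dist (\<gamma> (t i)) (\<gamma> (t (Suc i))))) \<le> c"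
  shows "curve_length \<gamma> a b \<le> c"
  unfolding curve_length_def using assms by (intro SUP_least) auto

lemma less_curve_lengthE:
  assumes "c < curve_length \<gamma> a b"
  obtains n t where "mono_on {..n} t" "t 0 = a" "t n = b"
    "c < (\<Sum>i<n. ennreal (dist (\<gamma> (t i)) (\<gamma> (t (Suc i)))))"
  using assms unfolding curve_length_def by (auto simp: less_SUP_iff)

lemma dist_le_curve_length:
  assumes "a \<le> b"
  shows "ennreal (dist (\<gamma> a) (\<gamma> b)) \<le> curve_length \<gamma> a b"
proof -
  have "mono_on {..1} (\<lambda>i::nat. if i = 0 then a else b)"
    using assms by (auto simp: mono_on_def)
  from partition_sum_le_curve_length[OF this, of a b \<gamma>] show ?thesis by simp
qed

lemma curve_length_refl [simp]: "curve_length \<gamma> a a = 0"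
proof -
  have "curve_length \<gamma> a a \<le> 0"
  proof (rule curve_length_leI)
    fix n and t :: "nat \<Rightarrow> real" assume t: "mono_on {..n} t" "t 0 = a" "t n = a"
    have "t i = a" if "i \<le> n" for i
      using mono_onD[OF t(1), of 0 i] mono_onD[OF t(1), of i n] t(2,3) that by auto
    then show "(\<Sum>i<n. ennreal (dist (\<gamma> (t i)) (\<gamma> (t (Suc i))))) \<le> 0" by simp
  qed
  then show ?thesis by simp
qed

text \<open>Gluing a partition of \<open>[a, b]\<close> to one of \<open>[b, c]\<close> gives a
  partition of \<open>[a, c]\<close> whose sum is the total of both sums. The two suprema are then
  taken one after the other.\<close>

lemma curve_length_concat_le:
  assumes "a \<le> b" "b \<le> c"
  shows "curve_length \<gamma> a b + curve_length \<gamma> b c \<le> curve_length \<gamma> a c"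
proof -
  let ?P = "\<lambda>a b. {(n::nat, t::nat \<Rightarrow> real). mono_on {..n} t \<and> t 0 = a \<and> t n = b}"
  let ?S = "\<lambda>(n, t). \<Sum>i<n. ennreal (dist (\<gamma> (t i)) (\<gamma> (t (Suc i))))"
  \<comment> \<open>A nonempty index set is what allows a summand to be moved into a supremum in
    \<open>ennreal\<close>.\<close>
  have ne: "?P u v \<noteq> {}" if "u \<le> v" for u v :: real
  proof -
    have "(1, \<lambda>i. if i = 0 then u else v) \<in> ?P u v" using that by (auto simp: mono_on_def)
    then show ?thesis by blast
  qed
  have *: "?S p + ?S q \<le> curve_length \<gamma> a c" if pq: "p \<in> ?P a b" "q \<in> ?P b c" for p q
  proof -
    obtain n t m s where p: "p = (n, t)" and q: "q = (m, s)" by (metis surj_pair)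
    have t: "mono_on {..n} t" "t 0 = a" "t n = b" and s: "mono_on {..m} s" "s 0 = b" "s m = c"
      using pq p q by auto
    \<comment> \<open>Index \<open>n\<close> is taken from \<open>t\<close>; since
      \<open>t n = b = s 0\<close>, the identity \<open>ws\<close> holds from \<open>i = 0\<close>
      on and the joint adds no extra distance.\<close>
    define w where "w i = (if i \<le> n then t i else s (i - n))" for i
    have "mono_on {..n + m} w"
    proof (rule mono_onI)
      fix i j assume ij: "i \<in> {..n + m}" "j \<in> {..n + m}" "i \<le> j"
      consider "j \<le> n" | "i \<le> n" "n < j" | "n < i" by linarith
      then show "w i \<le> w j"
      proof cases
        case 1
        then show ?thesis using mono_onD[OF t(1), of i j] ij by (simp add: w_def)
      next
        case 2
        have "t i \<le> b" using mono_onD[OF t(1), of i n] 2 t by simp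
        also have "b \<le> s (j - n)" using mono_onD[OF s(1), of 0 "j - n"] 2 s ij by simp
        finally show ?thesis using 2 by (simp add: w_def)
      next
        case 3
        then show ?thesis using mono_onD[OF s(1), of "i - n" "j - n"] ij by (simp add: w_def)
      qed
    qed
    moreover have "w 0 = a" "w (n + m) = c" using t s by (auto simp: w_def)
    ultimately have le: "?S (n + m, w) \<le> curve_length \<gamma> a c"
      using partition_sum_le_curve_length by fastforce
    have ws: "w (n + i) = s i" for i using t s by (auto simp: w_def)
    have ws': "w (Suc (n + i)) = s (Suc i)" for i using ws[of "Suc i"] by simp
    have split: "(\<Sum>i<n + m. f i) = (\<Sum>i<n. f i) + (\<Sum>i<m. f (n + i))" for f :: "nat \<Rightarrow> ennreal"
      by (induction m) (auto simp: add.assoc)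
    have "?S p = (\<Sum>i<n. ennreal (dist (\<gamma> (w i)) (\<gamma> (w (Suc i)))))"
      by (auto simp: p w_def simp del: sum_ennreal intro!: sum.cong)
    then have "?S p + ?S q = ?S (n + m, w)"
      by (simp add: split q ws ws' del: sum_ennreal)
    with le show ?thesis by simp
  qed
  have "?S p + (SUP q \<in> ?P b c. ?S q) \<le> curve_length \<gamma> a c" if "p \<in> ?P a b" for p
    unfolding ennreal_SUP_add_right[OF ne[OF assms(2)]]
    using * that by (intro SUP_least) blast
  then have "(SUP p \<in> ?P a b. ?S p) + (SUP q \<in> ?P b c. ?S q) \<le> curve_length \<gamma> a c"
    unfolding ennreal_SUP_add_left[OF ne[OF assms(1)], symmetric]
    by (intro SUP_least) blast
  then show ?thesis
    unfolding curve_length_def[of \<gamma> a b] curve_length_def[of \<gamma> b c] .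
qed

text \<open>Moving all points beyond \<open>b\<close> to \<open>b\<close> keeps a partition
  monotone, and the collapsed steps contribute zero. Unlike the insertion of \<open>b\<close> as a
  new point, clipping leaves the indices unchanged.\<close>

lemma clip_partition:
  fixes t :: "nat \<Rightarrow> real"
  assumes "mono_on {..n} t" "t 0 = a" "t n = c" "a \<le> b" "b \<le> c"
  shows "(\<Sum>i<n. ennreal (dist (\<gamma> (min (t i) b)) (\<gamma> (min (t (Suc i)) b)))) \<le> curve_length \<gamma> a b"
    and "(\<Sum>i<n. ennreal (dist (\<gamma> (max (t i) b)) (\<gamma> (max (t (Suc i)) b)))) \<le> curve_length \<gamma> b c"
proof -
  have "mono_on {..n} (\<lambda>i. min (t i) b)" "mono_on {..n} (\<lambda>i. max (t i) b)"
    using assms(1) by (fastforce simp: mono_on_def min_def max_def)+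
  from partition_sum_le_curve_length[OF this(1), of a b \<gamma>]
    partition_sum_le_curve_length[OF this(2), of b c \<gamma>] assms
  show "(\<Sum>i<n. ennreal (dist (\<gamma> (min (t i) b)) (\<gamma> (min (t (Suc i)) b)))) \<le> curve_length \<gamma> a b"
    and "(\<Sum>i<n. ennreal (dist (\<gamma> (max (t i) b)) (\<gamma> (max (t (Suc i)) b)))) \<le> curve_length \<gamma> b c"
    by simp_all
qed

text \<open>Concatenation gives one inequality. For the other, a partition of \<open>[a, c]\<close>
  is clipped at \<open>b\<close> from both sides and compared step by step.\<close>

lemma curve_length_add:
  assumes "a \<le> b" "b \<le> c"
  shows "curve_length \<gamma> a c = curve_length \<gamma> a b + curve_length \<gamma> b c"
proof (rule antisym)
  show "curve_length \<gamma> a c \<le> curve_length \<gamma> a b + curve_length \<gamma> b c"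
  proof (rule curve_length_leI)
    fix n and t :: "nat \<Rightarrow> real" assume t: "mono_on {..n} t" "t 0 = a" "t n = c"
    have "(\<Sum>i<n. ennreal (dist (\<gamma> (t i)) (\<gamma> (t (Suc i)))))
      \<le> (\<Sum>i<n. ennreal (dist (\<gamma> (min (t i) b)) (\<gamma> (min (t (Suc i)) b)))
             + ennreal (dist (\<gamma> (max (t i) b)) (\<gamma> (max (t (Suc i)) b))))"
    proof (rule sum_mono)
      fix i assume "i \<in> {..<n}"
      then have "t i \<le> t (Suc i)" using mono_onD[OF t(1), of i "Suc i"] by simp
      \<comment> \<open>In the first two cases one clipped distance is the original one and the
        other vanishes; the third is the triangle inequality through
        \<open>\<gamma> b\<close>.\<close>
      then consider "t (Suc i) \<le> b" | "b \<le> t i" | "t i \<le> b" "b \<le> t (Suc i)" by linarith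
      then show "ennreal (dist (\<gamma> (t i)) (\<gamma> (t (Suc i))))
        \<le> ennreal (dist (\<gamma> (min (t i) b)) (\<gamma> (min (t (Suc i)) b)))
             + ennreal (dist (\<gamma> (max (t i) b)) (\<gamma> (max (t (Suc i)) b)))"
        using \<open>t i \<le> t (Suc i)\<close>
        by cases (auto simp: min_absorb1 max_absorb2 min_absorb2 max_absorb1 dist_triangle
            simp flip: ennreal_plus)
    qed
    also have "\<dots> \<le> curve_length \<gamma> a b + curve_length \<gamma> b c"
      unfolding sum.distrib by (intro add_mono clip_partition[OF t assms])
    finally show "(\<Sum>i<n. ennreal (dist (\<gamma> (t i)) (\<gamma> (t (Suc i)))))
      \<le> curve_length \<gamma> a b + curve_length \<gamma> b c" .
  qed
qed (use assms in \<open>rule curve_length_concat_le\<close>)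

lemma curve_length_mono:
  assumes "a \<le> c" "c \<le> d" "d \<le> b"
  shows "curve_length \<gamma> c d \<le> curve_length \<gamma> a b"
proof -
  have "curve_length \<gamma> a b = curve_length \<gamma> a c + (curve_length \<gamma> c d + curve_length \<gamma> d b)"
    using assms by (subst curve_length_add[of a c b], simp_all add: curve_length_add[of c d b])
  then show ?thesis by (simp add: add_increasing add_increasing2)
qed

text \<open>A partition of \<open>[a, u]\<close> whose sum exceeds \<open>c\<close> still does so after clipping it to \<open>[a, t]\<close> with
  \<open>t\<close> close to \<open>u\<close>.\<close>

lemma curve_length_lower_semicontinuous:
  fixes \<gamma> :: "real \<Rightarrow> 'a::metric_space"
  assumes cont: "continuous_on {a..b} \<gamma>" and u: "u \<in> {a..b}"
  shows "c < curve_length \<gamma> a u \<Longrightarrow> \<forall>\<^sub>F t in at u within {a..b}. c < curve_length \<gamma> a t"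
    and "c < curve_length \<gamma> u b \<Longrightarrow> \<forall>\<^sub>F t in at u within {a..b}. c < curve_length \<gamma> t b"
proof -
  \<comment> \<open>The sum over a clipped partition is continuous in the clipping point;
    \<open>f i\<close> and \<open>g i\<close> stand for two neighbouring clipped points as functions
    of it.\<close>
  have cont': "((\<lambda>t. \<Sum>i<n. ennreal (dist (\<gamma> (f i t)) (\<gamma> (g i t)))) \<longlongrightarrow>
      (\<Sum>i<n. ennreal (dist (\<gamma> (f i u)) (\<gamma> (g i u))))) (at u within {a..b})"
    if "\<And>i. i < n \<Longrightarrow> continuous_on {a..b} (f i)" "\<And>i t. i < n \<Longrightarrow> t \<in> {a..b} \<Longrightarrow> f i t \<in> {a..b}"
      "\<And>i. i < n \<Longrightarrow> continuous_on {a..b} (g i)" "\<And>i t. i < n \<Longrightarrow> t \<in> {a..b} \<Longrightarrow> g i t \<in> {a..b}"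
    for n :: nat and f g
  proof (intro tendsto_sum tendsto_ennrealI tendsto_dist)
    fix i assume "i \<in> {..<n}"
    then have "continuous_on {a..b} (\<lambda>t. \<gamma> (f i t))" "continuous_on {a..b} (\<lambda>t. \<gamma> (g i t))"
      using that by (auto intro!: continuous_on_compose2[OF cont])
    then show "((\<lambda>t. \<gamma> (f i t)) \<longlongrightarrow> \<gamma> (f i u)) (at u within {a..b})"
      "((\<lambda>t. \<gamma> (g i t)) \<longlongrightarrow> \<gamma> (g i u)) (at u within {a..b})"
      using u by (auto simp: continuous_on_def)
  qed
  have inside: "\<forall>\<^sub>F t in at u within {a..b}. t \<in> {a..b}"
    by (auto simp: eventually_at_filter)
  show "\<forall>\<^sub>F t in at u within {a..b}. c < curve_length \<gamma> a t" if "c < curve_length \<gamma> a u"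
  proof -
    obtain n t where t: "mono_on {..n} t" "t 0 = a" "t n = u"
      and c: "c < (\<Sum>i<n. ennreal (dist (\<gamma> (t i)) (\<gamma> (t (Suc i)))))"
      using \<open>c < curve_length \<gamma> a u\<close> by (rule less_curve_lengthE)
    have tr: "a \<le> t i" "t i \<le> u" if "i \<le> n" for i
      using mono_onD[OF t(1), of 0 i] mono_onD[OF t(1), of i n] t(2,3) that by auto
    have "((\<lambda>v. \<Sum>i<n. ennreal (dist (\<gamma> (min (t i) v)) (\<gamma> (min (t (Suc i)) v)))) \<longlongrightarrow>
      (\<Sum>i<n. ennreal (dist (\<gamma> (min (t i) u)) (\<gamma> (min (t (Suc i)) u))))) (at u within {a..b})"
      using u by (intro cont' continuous_intros) (auto simp: tr le_max_iff_disj min_le_iff_disj)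
    moreover have "c < (\<Sum>i<n. ennreal (dist (\<gamma> (min (t i) u)) (\<gamma> (min (t (Suc i)) u))))"
      using c by (simp add: tr min_absorb1)
    ultimately have "\<forall>\<^sub>F v in at u within {a..b}.
        c < (\<Sum>i<n. ennreal (dist (\<gamma> (min (t i) v)) (\<gamma> (min (t (Suc i)) v))))"
      by (rule order_tendstoD)
    with inside show ?thesis
    proof eventually_elim
      \<comment> \<open>The clipped sum bounds the length for \<open>v\<close> to the left of
        \<open>u\<close>; to the right of \<open>u\<close> the length only grows.\<close>
      case (elim v)
      show ?case
      proof (cases "v \<le> u")
        case True
        then show ?thesis using elim clip_partition(1)[OF t, of v \<gamma>] by auto
      next
        case False
        then show ?thesis using u elim \<open>c < curve_length \<gamma> a u\<close> curve_length_mono[of a a u v \<gamma>]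
          by auto
      qed
    qed
  qed
  show "\<forall>\<^sub>F t in at u within {a..b}. c < curve_length \<gamma> t b" if "c < curve_length \<gamma> u b"
  proof -
    obtain n t where t: "mono_on {..n} t" "t 0 = u" "t n = b"
      and c: "c < (\<Sum>i<n. ennreal (dist (\<gamma> (t i)) (\<gamma> (t (Suc i)))))"
      using \<open>c < curve_length \<gamma> u b\<close> by (rule less_curve_lengthE)
    have tr: "u \<le> t i" "t i \<le> b" if "i \<le> n" for i
      using mono_onD[OF t(1), of 0 i] mono_onD[OF t(1), of i n] t(2,3) that by auto
    have "((\<lambda>v. \<Sum>i<n. ennreal (dist (\<gamma> (max (t i) v)) (\<gamma> (max (t (Suc i)) v)))) \<longlongrightarrow>
      (\<Sum>i<n. ennreal (dist (\<gamma> (max (t i) u)) (\<gamma> (max (t (Suc i)) u))))) (at u within {a..b})"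
      using u by (intro cont' continuous_intros) (auto simp: tr le_max_iff_disj)
    moreover have "c < (\<Sum>i<n. ennreal (dist (\<gamma> (max (t i) u)) (\<gamma> (max (t (Suc i)) u))))"
      using c by (simp add: tr max_absorb1)
    ultimately have "\<forall>\<^sub>F v in at u within {a..b}.
        c < (\<Sum>i<n. ennreal (dist (\<gamma> (max (t i) v)) (\<gamma> (max (t (Suc i)) v))))"
      by (rule order_tendstoD)
    with inside show ?thesis
    proof eventually_elim
      case (elim v)
      show ?case
      proof (cases "u \<le> v")
        case True
        then show ?thesis using elim clip_partition(2)[OF t, of v \<gamma>] by auto
      next
        case False
        then show ?thesis using u elim \<open>c < curve_length \<gamma> u b\<close> curve_length_mono[of v u b b \<gamma>]
          by auto
      qed
    qed
  qed
qed

text \<open>The lengths of the two pieces \<open>[a, t]\<close> and \<open>[t, b]\<close> are both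
  lower semicontinuous in \<open>t\<close> and have a constant finite sum, so each is also upper
  semicontinuous.\<close>

lemma continuous_on_curve_length:
  fixes \<gamma> :: "real \<Rightarrow> 'a::metric_space"
  assumes cont: "continuous_on {a..b} \<gamma>" and fin: "curve_length \<gamma> a b < \<infinity>"
  shows "continuous_on {a..b} (\<lambda>t. enn2real (curve_length \<gamma> a t))"
  unfolding continuous_on_def
proof (intro ballI order_tendstoI)
  let ?F = "\<lambda>t. enn2real (curve_length \<gamma> a t)" and ?G = "\<lambda>t. enn2real (curve_length \<gamma> t b)"
  have finF: "curve_length \<gamma> a t = ennreal (?F t)" and finG: "curve_length \<gamma> t b = ennreal (?G t)"
    if "t \<in> {a..b}" for t
    using that fin curve_length_mono[of a a t b \<gamma>] curve_length_mono[of a t b b \<gamma>]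
    by (auto simp: less_top intro!: ennreal_enn2real[symmetric] elim: le_less_trans)
  have sum: "?F b = ?F t + ?G t" if "t \<in> {a..b}" for t
  proof -
    have "ennreal (?F b) = ennreal (?F t + ?G t)"
      using that curve_length_add[of a t b \<gamma>] finF[of t] finG[of t] finF[of b]
        ennreal_plus[of "?F t" "?G t"] by (metis atLeastAtMost_iff enn2real_nonneg order_refl order_trans)
    then show ?thesis by (simp flip: ennreal_plus)
  qed
  have lessF: "ennreal c < curve_length \<gamma> a t \<longleftrightarrow> c < ?F t"
    and lessG: "ennreal c < curve_length \<gamma> t b \<longleftrightarrow> c < ?G t" if "t \<in> {a..b}" "0 \<le> c" for t c
    using that by (metis finF finG ennreal_less_iff)+
  fix u c assume u: "u \<in> {a..b}"
  have inside: "\<forall>\<^sub>F t in at u within {a..b}. t \<in> {a..b}"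
    by (auto simp: eventually_at_filter)
  show "\<forall>\<^sub>F t in at u within {a..b}. c < ?F t" if "c < ?F u"
  \<comment> \<open>\<open>ennreal\<close> sends negative numbers to 0, so \<open>lessF\<close> is
    restricted to \<open>0 \<le> c\<close>; a negative \<open>c\<close> lies below every
    length.\<close>
  proof (cases "c < 0")
    case True
    then show ?thesis by (auto intro!: always_eventually elim: less_le_trans)
  next
    case False
    then have "ennreal c < curve_length \<gamma> a u" using lessF[OF u] that by simp
    from curve_length_lower_semicontinuous(1)[OF cont u this] inside show ?thesis
    proof eventually_elim
      case (elim t)
      then show ?case using lessF[of t c] False by simp
    qed
  qed
  show "\<forall>\<^sub>F t in at u within {a..b}. ?F t < c" if "?F u < c"
  proof -
    \<comment> \<open>An upper bound for \<open>?F\<close> becomes a lower bound for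
      \<open>?G\<close>, to which lower semicontinuity applies.\<close>
    have less: "?F b - c < ?G u" using sum[OF u] that by simp
    show ?thesis
    proof (cases "?F b - c < 0")
      case True
      from inside show ?thesis
      proof eventually_elim
        case (elim t)
        then show ?case using True sum[of t] enn2real_nonneg[of "curve_length \<gamma> t b"] by linarith
      qed
    next
      case False
      then have "ennreal (?F b - c) < curve_length \<gamma> u b"
        using lessG[OF u] less by simp
      from curve_length_lower_semicontinuous(2)[OF cont u this] inside show ?thesis
      proof eventually_elim
        case (elim t)
        then have "?F b - c < ?G t" using lessG[of t] False by simp
        then show ?case using sum[of t] elim by simp
      qed
    qed
  qed
qed

section \<open>Integrals along curves\<close>

text \<open>By additivity the right-hand side is the length of the piece between the two times.
  Hence times of equal length have the same image, and the arc-length parametrization is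
  1-Lipschitz.\<close>

lemma dist_le_diff_curve_length:
  assumes "curve_length \<gamma> a b < \<infinity>" "t \<in> {a..b}" "t' \<in> {a..b}"
  shows "dist (\<gamma> t) (\<gamma> t') \<le> \<bar>enn2real (curve_length \<gamma> a t) - enn2real (curve_length \<gamma> a t')\<bar>"
proof -
  have *: "dist (\<gamma> t) (\<gamma> t') \<le> enn2real (curve_length \<gamma> a t') - enn2real (curve_length \<gamma> a t)"
    if "t \<in> {a..b}" "t' \<in> {a..b}" "t \<le> t'" for t t'
  proof -
    have fin: "curve_length \<gamma> u v < \<infinity>" if "a \<le> u" "u \<le> v" "v \<le> b" for u v
      using curve_length_mono[OF that, of \<gamma>] assms(1) by (rule le_less_trans)
    have "dist (\<gamma> t) (\<gamma> t') \<le> enn2real (curve_length \<gamma> t t')"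
      using enn2real_mono[OF dist_le_curve_length[of t t' \<gamma>]] fin[of t t'] that by simp
    also have "\<dots> = enn2real (curve_length \<gamma> a t') - enn2real (curve_length \<gamma> a t)"
      using that fin[of a t] fin[of t t'] curve_length_add[of a t t' \<gamma>] by (simp add: enn2real_plus)
    finally show ?thesis .
  qed
  show ?thesis
    using *[of t t'] *[of t' t] assms(2,3) by (cases "t \<le> t'") (auto simp: dist_commute)
qed

text \<open>The time picked by \<open>SOME\<close> may differ from \<open>t\<close>, but it has the
  same length from \<open>a\<close>, so its image is at distance 0 from
  \<open>\<gamma> t\<close>.\<close>

lemma arc_length_param_curve_length:
  assumes "curve_length \<gamma> a b < \<infinity>" "t \<in> {a..b}"
  shows "arc_length_param (a, b, \<gamma>) (enn2real (curve_length \<gamma> a t)) = \<gamma> t"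
proof -
  define t' where
    "t' = (SOME t'. t' \<in> {a..b} \<and> curve_length \<gamma> a t' = ennreal (enn2real (curve_length \<gamma> a t)))"
  have "curve_length \<gamma> a t < \<infinity>"
    using curve_length_mono[of a a t b \<gamma>] assms by (auto elim: le_less_trans)
  then have "t \<in> {a..b} \<and> curve_length \<gamma> a t = ennreal (enn2real (curve_length \<gamma> a t))"
    using assms by simp
  then have "t' \<in> {a..b} \<and> curve_length \<gamma> a t' = ennreal (enn2real (curve_length \<gamma> a t))"
    unfolding t'_def by (rule someI)
  then have "t' \<in> {a..b}" "enn2real (curve_length \<gamma> a t') = enn2real (curve_length \<gamma> a t)"
    by simp_all
  then have "\<gamma> t' = \<gamma> t"
    using dist_le_diff_curve_length[OF assms(1), of t' t] assms(2) by simp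
  then show ?thesis by (simp add: arc_length_param_def t'_def)
qed

text \<open>Intermediate value theorem for the continuous length function, which starts at
  0.\<close>

lemma curve_length_surj:
  assumes "continuous_on {a..b} \<gamma>" "curve_length \<gamma> a b < \<infinity>" "a \<le> b" "s \<in> arc_interval (a, b, \<gamma>)"
  obtains t where "t \<in> {a..b}" "s = enn2real (curve_length \<gamma> a t)"
  using IVT'[of "\<lambda>t. enn2real (curve_length \<gamma> a t)" a s b] assms
    continuous_on_curve_length[OF assms(1,2)] that
  by (auto simp: arc_interval_def)

lemma continuous_on_arc_length_param:
  assumes "continuous_on {a..b} \<gamma>" "curve_length \<gamma> a b < \<infinity>" "a \<le> b"
  shows "continuous_on (arc_interval (a, b, \<gamma>)) (arc_length_param (a, b, \<gamma>))"
proof -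
  have "dist (arc_length_param (a, b, \<gamma>) s) (arc_length_param (a, b, \<gamma>) s') \<le> dist s s'"
    if "s \<in> arc_interval (a, b, \<gamma>)" "s' \<in> arc_interval (a, b, \<gamma>)" for s s'
    using curve_length_surj[OF assms that(1)] curve_length_surj[OF assms that(2)]
      dist_le_diff_curve_length[OF assms(2)] arc_length_param_curve_length[OF assms(2)]
    by (metis dist_real_def)
  then show ?thesis
    unfolding continuous_on_iff by (meson le_less_trans)
qed

lemma arc_length_param_in_image:
  assumes "continuous_on {a..b} \<gamma>" "curve_length \<gamma> a b < \<infinity>" "a \<le> b" "s \<in> arc_interval (a, b, \<gamma>)"
  shows "arc_length_param (a, b, \<gamma>) s \<in> \<gamma> ` {a..b}"
  using curve_length_surj[OF assms] arc_length_param_curve_length[OF assms(2)] by (metis imageI)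

text \<open>The cutoff by the indicator of the closed parameter interval turns measurability on that
  interval into measurability on the line.\<close>

lemma borel_measurable_arc_length_param:
  assumes "continuous_on {a..b} \<gamma>" "curve_length \<gamma> a b < \<infinity>" "a \<le> b" and g: "g \<in> borel_measurable borel"
  shows "(\<lambda>s. g (arc_length_param (a, b, \<gamma>) s) * indicator (arc_interval (a, b, \<gamma>)) s :: ennreal)
    \<in> borel_measurable borel"
proof -
  have "arc_length_param (a, b, \<gamma>) \<in> borel_measurable (restrict_space borel (arc_interval (a, b, \<gamma>)))"
    by (intro borel_measurable_continuous_on_restrict continuous_on_arc_length_param assms)
  from measurable_compose[OF this g]
  show ?thesis
    by (subst borel_measurable_restrict_space_iff_ennreal[symmetric]) (auto simp: arc_interval_def)
qed

text \<open>The arc-length parametrization over \<open>[a, b]\<close> agrees with that over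
  \<open>[a, c]\<close> up to the parameter \<open>F a c\<close>, and after a shift by
  \<open>F a c\<close> with that over \<open>[c, b]\<close>.\<close>

lemma curve_integral_add:
  assumes "continuous_on {a..b} \<gamma>" "curve_length \<gamma> a b < \<infinity>" and c: "a \<le> c" "c \<le> b"
    and g: "g \<in> borel_measurable borel"
  shows "curve_integral g (a, b, \<gamma>) = curve_integral g (a, c, \<gamma>) + curve_integral g (c, b, \<gamma>)"
proof -
  define F where "F u v = enn2real (curve_length \<gamma> u v)" for u v
  let ?P = "arc_length_param (a, b, \<gamma>)"
  define f where "f = (\<lambda>s. g (?P s) * indicator {0..F a b} s)"
  have "a \<le> b" using c by simp
  note ab = assms(1,2) this
  have fin: "curve_length \<gamma> u v < \<infinity>" if "a \<le> u" "u \<le> v" "v \<le> b" for u v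
    using curve_length_mono[OF that, of \<gamma>] ab(2) by (rule le_less_trans)
  have ac: "continuous_on {a..c} \<gamma>" "curve_length \<gamma> a c < \<infinity>" "a \<le> c"
    and cb: "continuous_on {c..b} \<gamma>" "curve_length \<gamma> c b < \<infinity>" "c \<le> b"
    using fin c by (auto intro: continuous_on_subset[OF assms(1)])
  have F_add: "F a t = F a c + F c t" if "c \<le> t" "t \<le> b" for t
    using that fin[of a c] fin[of c t] c curve_length_add[of a c t \<gamma>]
    by (simp add: F_def enn2real_plus)
  have F_nonneg: "0 \<le> F u v" for u v by (simp add: F_def)
  have f [measurable]: "f \<in> borel_measurable borel"
    using borel_measurable_arc_length_param[OF ab g] by (simp add: f_def arc_interval_def F_def)
  have "curve_integral g (a, b, \<gamma>) = (\<integral>\<^sup>+ s. f s \<partial>lborel)"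
    by (simp add: curve_integral_def nn_integral_completion f_def arc_interval_def F_def)
  \<comment> \<open>The two closed intervals overlap in the single point \<open>F a c\<close>, a
    null set.\<close>
  also have "\<dots> = (\<integral>\<^sup>+ s. f s * indicator {0..F a c} s + f s * indicator {F a c..F a b} s \<partial>lborel)"
    using AE_lborel_singleton[of "F a c"]
    by (intro nn_integral_cong_AE) (auto elim!: eventually_mono simp: f_def indicator_def)
  also have "\<dots> = (\<integral>\<^sup>+ s. f s * indicator {0..F a c} s \<partial>lborel)
      + (\<integral>\<^sup>+ s. f s * indicator {F a c..F a b} s \<partial>lborel)"
    by (rule nn_integral_add) measurable
  also have "(\<integral>\<^sup>+ s. f s * indicator {0..F a c} s \<partial>lborel) = curve_integral g (a, c, \<gamma>)"
    unfolding curve_integral_def nn_integral_completion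
  proof (rule nn_integral_cong)
    fix s
    show "f s * indicator {0..F a c} s
      = g (arc_length_param (a, c, \<gamma>) s) * indicator (arc_interval (a, c, \<gamma>)) s"
    proof (cases "s \<in> arc_interval (a, c, \<gamma>)")
      case True
      then obtain t where t: "t \<in> {a..c}" "s = enn2real (curve_length \<gamma> a t)"
        using curve_length_surj[OF ac] by blast
      have "?P s = arc_length_param (a, c, \<gamma>) s"
        using t c arc_length_param_curve_length[OF ac(2), of t]
          arc_length_param_curve_length[OF ab(2), of t] by simp
      moreover have "s \<le> F a b"
        using True F_add[of b] F_nonneg[of c b] c by (simp add: arc_interval_def flip: F_def)
      ultimately show ?thesis
        using True
          by (auto simp: f_def F_def arc_interval_def indicator_def)
    next
      case False
      then show ?thesis by (simp add: arc_interval_def F_def)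
    qed
  qed
  \<comment> \<open>Translation by \<open>F a c\<close>; the factor 1 is the slope in the affine
    substitution rule.\<close>
  also have "(\<integral>\<^sup>+ s. f s * indicator {F a c..F a b} s \<partial>lborel)
    = (\<integral>\<^sup>+ s. f (F a c + 1 * s) * indicator {F a c..F a b} (F a c + 1 * s) \<partial>lborel)"
    by (subst nn_integral_real_affine[where c = 1 and t = "F a c"]) auto
  also have "\<dots> = curve_integral g (c, b, \<gamma>)"
    unfolding curve_integral_def nn_integral_completion
  proof (rule nn_integral_cong)
    fix s
    show "f (F a c + 1 * s) * indicator {F a c..F a b} (F a c + 1 * s)
      = g (arc_length_param (c, b, \<gamma>) s) * indicator (arc_interval (c, b, \<gamma>)) s"
    proof (cases "s \<in> arc_interval (c, b, \<gamma>)")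
      case True
      then obtain t where t: "t \<in> {c..b}" "s = enn2real (curve_length \<gamma> c t)"
        using curve_length_surj[OF cb] by blast
      have "?P (F a c + s) = arc_length_param (c, b, \<gamma>) s"
        using t c arc_length_param_curve_length[OF cb(2), of t]
          arc_length_param_curve_length[OF ab(2), of t] F_add[of t] by (simp add: F_def)
      then show ?thesis
        using True F_add[of b] F_nonneg[of a c] c
          by (auto simp: f_def F_def arc_interval_def indicator_def)
    next
      case False
      then show ?thesis using F_add[of b] c by (auto simp: arc_interval_def F_def indicator_def)
    qed
  qed
  finally show ?thesis .
qed

section \<open>Zero extension\<close>

lemma restrict_space_UNIV [simp]: "restrict_space M UNIV = M"
  by (rule measure_eqI) (auto simp: sets_restrict_space emeasure_restrict_space)

text \<open>At the first time \<open>t1\<close> outside \<open>B\<close> the curve is off the closed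
  set \<open>K\<close>, hence also shortly before \<open>t1\<close>, while it is still in
  \<open>B\<close>. With \<open>K\<close> the support of a function, this gives a zero of the
  function inside \<open>B\<close>.\<close>

lemma exit_time:
  fixes \<gamma> :: "real \<Rightarrow> 'a::metric_space"
  assumes cont: "continuous_on {a..b} \<gamma>" and "a \<le> b" and B: "open B" "\<gamma> a \<in> B" "\<gamma> b \<notin> B"
    and K: "closed K" "K \<subseteq> B"
  obtains t where "t \<in> {a..b}" "\<gamma> ` {a..t} \<subseteq> B" "\<gamma> t \<notin> K"
proof -
  let ?S = "{a..b} \<inter> \<gamma> -` (- B)"
  have S: "closed ?S" "?S \<noteq> {}" "bdd_below ?S"
    using continuous_closed_preimage[OF cont] B \<open>a \<le> b\<close> by (auto simp: closed_Compl)
  define t1 where "t1 = Inf ?S"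
  have t1: "t1 \<in> {a..b}" "\<gamma> t1 \<notin> B"
    using closed_contains_Inf[OF S(2,3,1)] by (auto simp: t1_def)
  have before: "\<gamma> t \<in> B" if "a \<le> t" "t < t1" for t
    using cInf_lower[OF _ S(3), of t] that t1 by (force simp: t1_def)
  have "a < t1" using t1 B by (metis atLeastAtMost_iff order_le_less)
  have "open (- K)" "\<gamma> t1 \<in> - K" using K t1 by auto
  moreover have "(\<gamma> \<longlongrightarrow> \<gamma> t1) (at t1 within {a..b})"
    using cont t1 by (auto simp: continuous_on_def)
  ultimately have "\<forall>\<^sub>F t in at t1 within {a..b}. \<gamma> t \<in> - K"
    by (rule topological_tendstoD[rotated])
  then obtain d where d: "d > 0" "\<And>t. t \<in> {a..b} \<Longrightarrow> t \<noteq> t1 \<Longrightarrow> dist t t1 < d \<Longrightarrow> \<gamma> t \<notin> K"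
    by (auto simp: eventually_at)
  \<comment> \<open>Strictly before \<open>t1\<close>, so that the curve stays in \<open>B\<close>
    on \<open>[a, t]\<close>; the maximum keeps \<open>t\<close> in the domain.\<close>
  define t where "t = max a (t1 - d / 2)"
  have t: "a \<le> t" "t < t1" "dist t t1 < d"
    using \<open>a < t1\<close> d(1) by (auto simp: t_def dist_real_def)
  then have "\<gamma> ` {a..t} \<subseteq> B" using before by auto
  then show ?thesis
    using that[of t] t t1 d(2)[of t] by auto
qed

text \<open>The exit time of the curve run backwards.\<close>

lemma entry_time:
  fixes \<gamma> :: "real \<Rightarrow> 'a::metric_space"
  assumes cont: "continuous_on {a..b} \<gamma>" and "a \<le> b" and B: "open B" "\<gamma> b \<in> B" "\<gamma> a \<notin> B"
    and K: "closed K" "K \<subseteq> B"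
  obtains t where "t \<in> {a..b}" "\<gamma> ` {t..b} \<subseteq> B" "\<gamma> t \<notin> K"
proof -
  have "continuous_on {- b..- a} (\<lambda>t. \<gamma> (- t))"
    by (rule continuous_on_compose2[OF cont]) (auto intro!: continuous_intros)
  then obtain t where t: "t \<in> {- b..- a}" "(\<lambda>t. \<gamma> (- t)) ` {- b..t} \<subseteq> B" "\<gamma> (- t) \<notin> K"
    using exit_time[of "- b" "- a" "\<lambda>t. \<gamma> (- t)" B K] assms by auto
  have "\<gamma> s \<in> B" if "s \<in> {- t..b}" for s
    using t(2) that by (force simp: image_subset_iff dest: bspec[of _ _ "- s"])
  then have "\<gamma> ` {- t..b} \<subseteq> B" by blast
  with t show ?thesis using that[of "- t"] by auto
qed

section \<open>Upper gradients of functions with compact support\<close>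

text \<open>With a zero at one end, the difference in the upper gradient inequality is the value at
  the other end. Constant curves are excluded from \<open>paths_in\<close> and are treated
  separately: there both values are 0.\<close>

lemma upper_gradient_zero_endpoint:
  assumes "upper_gradient \<Omega> u g" "a \<le> b" "continuous_on {a..b} \<gamma>" "curve_length \<gamma> a b < \<infinity>"
    "\<gamma> ` {a..b} \<subseteq> \<Omega>" "u (\<gamma> a) = 0 \<or> u (\<gamma> b) = 0"
  shows "e2ennreal \<bar>u (\<gamma> a)\<bar> \<le> curve_integral g (a, b, \<gamma>)"
    and "e2ennreal \<bar>u (\<gamma> b)\<bar> \<le> curve_integral g (a, b, \<gamma>)"
proof -
  have "e2ennreal \<bar>u (\<gamma> a)\<bar> \<le> curve_integral g (a, b, \<gamma>)
      \<and> e2ennreal \<bar>u (\<gamma> b)\<bar> \<le> curve_integral g (a, b, \<gamma>)"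
  proof (cases "\<gamma> constant_on {a..b}")
    case True
    then have "\<gamma> a = \<gamma> b" using assms(2) by (auto simp: constant_on_def)
    then show ?thesis using assms(6) by (auto simp flip: zero_ennreal.abs_eq)
  next
    case False
    then have "(a, b, \<gamma>) \<in> paths_in \<Omega>" using assms by (simp add: paths_in_def)
    then have "ug_inequality u g (a, b, \<gamma>)"
      using assms(1) by (simp add: upper_gradient_def)
    then show ?thesis
      using assms(6) by (auto simp: ug_inequality_def simp flip: zero_ennreal.abs_eq split: if_splits)
  qed
  then show "e2ennreal \<bar>u (\<gamma> a)\<bar> \<le> curve_integral g (a, b, \<gamma>)"
    and "e2ennreal \<bar>u (\<gamma> b)\<bar> \<le> curve_integral g (a, b, \<gamma>)" by auto
qed

lemma curve_integral_cong:
  assumes "continuous_on {a..b} \<gamma>" "curve_length \<gamma> a b < \<infinity>" "a \<le> b"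
    "\<And>x. x \<in> \<gamma> ` {a..b} \<Longrightarrow> g x = h x"
  shows "curve_integral g (a, b, \<gamma>) = curve_integral h (a, b, \<gamma>)"
  unfolding curve_integral_def
  using assms(4) arc_length_param_in_image[OF assms(1-3)]
  by (intro nn_integral_cong) (auto simp: indicator_def)

lemma e2ennreal_abs_diff_le: "e2ennreal \<bar>x - y\<bar> \<le> e2ennreal \<bar>x\<bar> + e2ennreal \<bar>y\<bar>"
proof -
  have "\<bar>x - y\<bar> \<le> \<bar>x\<bar> + \<bar>y\<bar>"
    by (cases x; cases y) auto
  then have "e2ennreal \<bar>x - y\<bar> \<le> e2ennreal (\<bar>x\<bar> + \<bar>y\<bar>)" by (rule e2ennreal_mono)
  also have "\<dots> = e2ennreal \<bar>x\<bar> + e2ennreal \<bar>y\<bar>"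
    by (simp add: plus_ennreal.abs_eq eq_onp_same_args)
  finally show ?thesis .
qed

text \<open>A path in \<open>B\<close> inherits the inequality. Any other path is cut at a time
  \<open>c\<close> outside \<open>B\<close>; the two pieces bound the values at the two ends
  separately, and the bounds add up.\<close>

lemma upper_gradient_zero_extension:
  fixes u :: "'a::metric_space \<Rightarrow> ereal" and g :: "'a \<Rightarrow> ennreal"
  assumes B: "open B" and ug: "upper_gradient B u g" and K: "closure {x \<in> B. u x \<noteq> 0} \<subseteq> B"
  shows "upper_gradient UNIV (\<lambda>x. if x \<in> B then u x else 0) (\<lambda>x. g x * indicator B x)"
proof -
  define v where "v = (\<lambda>x. if x \<in> B then u x else 0)"
  define h where "h = (\<lambda>x. g x * indicator B x)"
  let ?K = "closure {x \<in> B. u x \<noteq> 0}"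
  have h: "h \<in> borel_measurable borel"
    unfolding h_def using ug B
    by (subst borel_measurable_restrict_space_iff_ennreal[symmetric]) (auto simp: upper_gradient_def)
  have v_eq_u: "v x = u x" if "x \<in> B" for x using that by (simp add: v_def)
  have v_outside: "v x = 0" if "x \<notin> ?K" for x
    using that closure_subset[of "{x \<in> B. u x \<noteq> 0}"] by (auto simp: v_def)
  \<comment> \<open>Inside \<open>B\<close> nothing changes under extension, so the estimate for a
    zero endpoint carries over to \<open>v\<close> and \<open>h\<close>.\<close>
  have inside: "e2ennreal \<bar>v (\<gamma> a)\<bar> \<le> curve_integral h (a, b, \<gamma>)"
    "e2ennreal \<bar>v (\<gamma> b)\<bar> \<le> curve_integral h (a, b, \<gamma>)"
    if "a \<le> b" "continuous_on {a..b} \<gamma>" "curve_length \<gamma> a b < \<infinity>" "\<gamma> ` {a..b} \<subseteq> B"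
      "v (\<gamma> a) = 0 \<or> v (\<gamma> b) = 0" for a b \<gamma>
  proof -
    have "curve_integral h (a, b, \<gamma>) = curve_integral g (a, b, \<gamma>)"
      using that by (intro curve_integral_cong) (auto simp: h_def)
    moreover have "v (\<gamma> a) = u (\<gamma> a)" "v (\<gamma> b) = u (\<gamma> b)"
      using that by (auto intro!: v_eq_u)
    ultimately show "e2ennreal \<bar>v (\<gamma> a)\<bar> \<le> curve_integral h (a, b, \<gamma>)"
      "e2ennreal \<bar>v (\<gamma> b)\<bar> \<le> curve_integral h (a, b, \<gamma>)"
      using upper_gradient_zero_endpoint[OF ug that(1-4)] that(5) by auto
  qed
  have "ug_inequality v h p" if path: "p \<in> paths_in UNIV" for p
  proof -
    obtain a b \<gamma> where p: "p = (a, b, \<gamma>)" by (metis surj_pair)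
    have ab: "continuous_on {a..b} \<gamma>" "curve_length \<gamma> a b < \<infinity>" "a \<le> b" "\<not> \<gamma> constant_on {a..b}"
      using path by (auto simp: p paths_in_def)
    show ?thesis
    proof (cases "\<gamma> ` {a..b} \<subseteq> B")
      case True
      then have "(a, b, \<gamma>) \<in> paths_in B" using ab by (simp add: paths_in_def)
      then have "ug_inequality u g (a, b, \<gamma>)" using ug by (simp add: upper_gradient_def)
      moreover have "curve_integral h (a, b, \<gamma>) = curve_integral g (a, b, \<gamma>)"
        using ab True by (intro curve_integral_cong) (auto simp: h_def)
      moreover have "v (\<gamma> a) = u (\<gamma> a)" "v (\<gamma> b) = u (\<gamma> b)"
        using ab True by (auto intro!: v_eq_u)
      ultimately show ?thesis by (simp add: p ug_inequality_def)
    next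
      case False
      then obtain c where c: "a \<le> c" "c \<le> b" "\<gamma> c \<notin> B" by (auto simp: image_subset_iff)
      have sub: "continuous_on {s..t} \<gamma>" "curve_length \<gamma> s t < \<infinity>" if "a \<le> s" "s \<le> t" "t \<le> b" for s t
        using that curve_length_mono[OF that, of \<gamma>] ab
        by (auto intro: continuous_on_subset[OF ab(1)] elim: le_less_trans)
      have "e2ennreal \<bar>v (\<gamma> a)\<bar> \<le> curve_integral h (a, c, \<gamma>)"
      proof (cases "\<gamma> a \<in> ?K")
        case True
        have "\<gamma> a \<in> B" using True K by auto
        then obtain t where t: "t \<in> {a..c}" "\<gamma> ` {a..t} \<subseteq> B" "\<gamma> t \<notin> ?K"
          using exit_time[OF sub(1)[of a c] c(1) B _ c(3) closed_closure K] c by auto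
        have "e2ennreal \<bar>v (\<gamma> a)\<bar> \<le> curve_integral h (a, t, \<gamma>)"
          using t c sub[of a t] by (intro inside) (auto simp: v_outside)
        also have "\<dots> \<le> curve_integral h (a, c, \<gamma>)"
          using curve_integral_add[OF sub[of a c] _ _ h, of t] t c by (simp add: add_increasing2)
        finally show ?thesis .
      qed (simp add: v_outside flip: zero_ennreal.abs_eq)
      moreover have "e2ennreal \<bar>v (\<gamma> b)\<bar> \<le> curve_integral h (c, b, \<gamma>)"
      proof (cases "\<gamma> b \<in> ?K")
        case True
        have "\<gamma> b \<in> B" using True K by auto
        then obtain t where t: "t \<in> {c..b}" "\<gamma> ` {t..b} \<subseteq> B" "\<gamma> t \<notin> ?K"
          using entry_time[OF sub(1)[of c b] c(2) B _ c(3) closed_closure K] c by auto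
        have "e2ennreal \<bar>v (\<gamma> b)\<bar> \<le> curve_integral h (t, b, \<gamma>)"
          using t c sub[of t b] by (intro inside) (auto simp: v_outside)
        also have "\<dots> \<le> curve_integral h (c, b, \<gamma>)"
          using curve_integral_add[OF sub[of c b] _ _ h, of t] t c by (simp add: add_increasing)
        finally show ?thesis .
      qed (simp add: v_outside flip: zero_ennreal.abs_eq)
      ultimately have le: "e2ennreal \<bar>v (\<gamma> a)\<bar> + e2ennreal \<bar>v (\<gamma> b)\<bar> \<le> curve_integral h (a, b, \<gamma>)"
        unfolding curve_integral_add[OF ab(1,2) c(1,2) h] by (rule add_mono)
      have "e2ennreal \<bar>v (\<gamma> a) - v (\<gamma> b)\<bar> \<le> curve_integral h (a, b, \<gamma>)"
        using e2ennreal_abs_diff_le le by (rule order_trans)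
      \<comment> \<open>The sum of both values, not only their difference, is bounded; so an
        infinite value at either end forces an infinite integral.\<close>
      moreover have "curve_integral h (a, b, \<gamma>) = \<infinity>" if "\<bar>v (\<gamma> a)\<bar> = \<infinity> \<or> \<bar>v (\<gamma> b)\<bar> = \<infinity>"
        using le that by (auto simp: top_unique infinity_ennreal_def)
      ultimately show ?thesis by (auto simp: p ug_inequality_def)
    qed
  qed
  then show ?thesis using h by (simp add: upper_gradient_def v_def h_def restrict_space_UNIV)
qed

section \<open>The Friedrichs inequality and the capacities\<close>

lemma space_caratheodory [simp]: "space (caratheodory \<mu>) = UNIV"
  by (simp add: caratheodory_def space_measure_of_conv)

text \<open>By Caratheodory's theorem the lambda system is a sigma-algebra on which
  \<open>\<mu>\<close> is a measure, so \<open>measure_of\<close> neither enlarges the sets nor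
  changes the values.\<close>

lemma
  assumes "borel_regular_outer_measure \<mu>"
  shows sets_caratheodory: "sets (caratheodory \<mu>) = lambda_system UNIV (Pow UNIV) \<mu>"
    and sets_borel_subset_caratheodory: "sets borel \<subseteq> sets (caratheodory \<mu>)"
    and emeasure_caratheodory: "A \<in> sets (caratheodory \<mu>) \<Longrightarrow> emeasure (caratheodory \<mu>) A = \<mu> A"
proof -
  have "outer_measure_space (Pow UNIV) \<mu>"
    using assms by (simp add: borel_regular_outer_measure_def)
  then have ms: "measure_space UNIV (lambda_system UNIV (Pow UNIV) \<mu>) \<mu>"
    by (rule sigma_algebra.caratheodory_lemma[OF sigma_algebra_Pow])
  then have sa: "sigma_algebra UNIV (lambda_system UNIV (Pow UNIV) \<mu>)"
    by (simp add: measure_space_def)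
  show sets: "sets (caratheodory \<mu>) = lambda_system UNIV (Pow UNIV) \<mu>"
    unfolding caratheodory_def using sigma_algebra.sets_measure_of_eq[OF sa] .
  then show "sets borel \<subseteq> sets (caratheodory \<mu>)"
    using assms by (simp add: borel_regular_outer_measure_def)
  show "emeasure (caratheodory \<mu>) A = \<mu> A" if "A \<in> sets (caratheodory \<mu>)"
    unfolding caratheodory_def using ms that sets
    by (intro emeasure_measure_of_sigma) (auto simp: measure_space_def)
qed

lemma borel_measurable_caratheodory:
  fixes f :: "'a::metric_space \<Rightarrow> 'b::topological_space"
  assumes "borel_regular_outer_measure \<mu>" "f \<in> borel_measurable borel"
  shows "f \<in> borel_measurable (caratheodory \<mu>)"
  using measurable_mono[of borel borel borel "caratheodory \<mu>"]
    sets_borel_subset_caratheodory[OF assms(1)] assms(2) by auto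

text \<open>The exceptional family is empty; its modulus is 0 because \<open>\<rho> = 0\<close> is
  admissible for it.\<close>

lemma upper_gradient_imp_weak_upper_gradient1:
  assumes \<mu>: "borel_regular_outer_measure \<mu>" and ug: "upper_gradient UNIV u g"
  shows "weak_upper_gradient1 \<mu> UNIV u g"
proof -
  have g: "g \<in> borel_measurable borel"
    using ug by (simp add: upper_gradient_def restrict_space_UNIV)
  have "modulus1 \<mu> UNIV {} \<le> (\<integral>\<^sup>+ x \<in> UNIV. 0 \<partial>caratheodory \<mu>)"
    unfolding modulus1_def by (rule INF_lower2[where i = "\<lambda>_. 0"]) auto
  then have "modulus1 \<mu> UNIV {} = 0" by simp
  moreover have "curve_integral_well_defined g p" if "p \<in> paths_in UNIV" for p
  proof -
    obtain a b \<gamma> where p: "p = (a, b, \<gamma>)" by (metis surj_pair)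
    have "(\<lambda>s. g (arc_length_param p s) * indicator (arc_interval p) s) \<in> borel_measurable borel"
      unfolding p using that g by (intro borel_measurable_arc_length_param) (auto simp: p paths_in_def)
    then have "(\<lambda>s. g (arc_length_param p s) * indicator (arc_interval p) s) \<in> borel_measurable lebesgue"
      by (intro measurable_completion) simp
    then show ?thesis
      unfolding curve_integral_well_defined_def
      by (subst borel_measurable_restrict_space_iff_ennreal) (auto simp: p arc_interval_def)
  qed
  ultimately show ?thesis
    using ug borel_measurable_caratheodory[OF \<mu> g]
    by (auto simp: weak_upper_gradient1_def upper_gradient_def restrict_space_UNIV intro!: exI[of _ "{}"])
qed

section \<open>Doubling and the Friedrichs inequality\<close>

lemma doubling_power:
  assumes "doubling C \<mu>" "0 < r"
  shows "\<mu> (ball x (2 ^ k * r)) \<le> ennreal C ^ k * \<mu> (ball x r)"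
proof (induction k)
  case (Suc k)
  have "\<mu> (ball x (2 * (2 ^ k * r))) \<le> ennreal C * \<mu> (ball x (2 ^ k * r))"
    using assms by (simp add: doubling_def)
  also have "\<dots> \<le> ennreal C * (ennreal C ^ k * \<mu> (ball x r))"
    by (intro mult_left_mono Suc) simp
  finally show ?case by (simp add: mult.assoc)
qed simp

lemma ennreal_divide_mono:
  fixes a b m n :: ennreal
  assumes "a \<le> b" "m \<le> n" "0 < m" "m < top"
  shows "a / n \<le> b / m"
proof (rule divide_le_posI_ennreal)
  have "b = m * (b / m)"
    using assms(3,4) by (simp add: ennreal_times_divide mult_divide_eq_ennreal mult.commute)
  with assms(1,2) show "a \<le> n * (b / m)" by (metis mult_right_mono order_trans zero_le)
qed (use assms in auto)

text \<open>\<open>R\<close> is so large that the ball \<open>B'\<close> of radius \<open>R\<close>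
  around the centre of \<open>B\<close> contains \<open>B\<close> and \<open>ball z \<rho>\<close>;
  \<open>k\<close> counts the doublings of the latter ball after which it covers
  \<open>B'\<close>.\<close>

lemma friedrichs_inequality:
  fixes u :: "'a::metric_space \<Rightarrow> ereal" and x\<^sub>0 z :: 'a and r \<rho> R :: real
  defines "B \<equiv> ball x\<^sub>0 r"
  assumes \<mu>: "borel_regular_outer_measure \<mu>" and dbl: "doubling C\<^sub>D \<mu>"
    and P: "weak_poincare11 C\<^sub>P \<tau> \<mu>" "0 < C\<^sub>P" "1 \<le> \<tau>"
    and z: "0 < \<rho>" "ball z \<rho> \<inter> B = {}"
    and R: "0 < r" "r \<le> R" "dist x\<^sub>0 z + \<rho> \<le> R" "2 * R \<le> 2 ^ k * \<rho>"
    and u: "u \<in> N11 \<mu> B" "upper_gradient B u g" "closure {x \<in> B. u x \<noteq> 0} \<subseteq> B"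
  shows "(\<integral>\<^sup>+ x \<in> B. e2ennreal \<bar>u x\<bar> \<partial>caratheodory \<mu>)
    \<le> (1 + ennreal C\<^sub>D ^ k) * ennreal (C\<^sub>P * R) * (\<integral>\<^sup>+ x \<in> B. g x \<partial>caratheodory \<mu>)"
proof -
  let ?M = "caratheodory \<mu>"
  define v where "v = (\<lambda>x. if x \<in> B then u x else 0)"
  define h where "h = (\<lambda>x. g x * indicator B x)"
  define B' D where "B' = ball x\<^sub>0 R" and "D = ball z \<rho>"
  define c where "c = mean_value \<mu> B' v"
  have [measurable]: "ball x s \<in> sets ?M" for x s
    using sets_borel_subset_caratheodory[OF \<mu>] by auto
  then have [measurable]: "B \<in> sets ?M" "B' \<in> sets ?M" "D \<in> sets ?M"
    by (simp_all add: B_def B'_def D_def)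
  have em: "\<mu> (ball x s) = emeasure ?M (ball x s)" for x s
    using emeasure_caratheodory[OF \<mu>] by simp
  have ball_pos: "0 < emeasure ?M (ball x s)" "emeasure ?M (ball x s) < \<infinity>" if "0 < s" for x s
    using dbl that by (auto simp: doubling_def em)
  have mball: "ball x s \<subseteq> ball y t" if "dist x y + s \<le> t" for x y :: 'a and s t
  proof
    fix w assume "w \<in> ball x s"
    then show "w \<in> ball y t" using that dist_triangle[of y w x] by (simp add: dist_commute)
  qed
  have "D \<subseteq> B'" "B' \<subseteq> ball z (2 ^ k * \<rho>)" "B \<subseteq> B'"
    using R z(1) unfolding D_def B'_def B_def
    by (intro mball; simp add: dist_commute)+
  \<comment> \<open>In product form, measurability on \<open>B\<close> passes to the whole
    space.\<close>
  have "v = (\<lambda>x. u x * indicator B x)" by (auto simp: v_def)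
  then have [measurable]: "v \<in> borel_measurable ?M"
    using u(1) by (simp add: N11_def borel_measurable_restrict_space_iff_ereal)
  have v_int: "(\<integral>\<^sup>+ x. e2ennreal \<bar>v x\<bar> \<partial>?M) = (\<integral>\<^sup>+ x \<in> B. e2ennreal \<bar>u x\<bar> \<partial>?M)"
    by (intro nn_integral_cong) (auto simp: v_def simp flip: zero_ennreal.abs_eq)
  have "locally_integrable \<mu> v"
  proof -
    have "(\<integral>\<^sup>+ y \<in> ball x 1. e2ennreal \<bar>v y\<bar> \<partial>?M) < \<infinity>" for x
    proof -
      have "(\<integral>\<^sup>+ y \<in> ball x 1. e2ennreal \<bar>v y\<bar> \<partial>?M) \<le> (\<integral>\<^sup>+ y. e2ennreal \<bar>v y\<bar> \<partial>?M)"
        by (intro nn_integral_mono) (auto simp: indicator_def)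
      also have "\<dots> < \<infinity>"
        using u(1) by (auto simp: v_int N11_def N11_norm_def)
      finally show ?thesis .
    qed
    then show ?thesis by (auto simp: locally_integrable_def intro!: exI[of _ 1])
  qed
  moreover have "upper_gradient UNIV v h"
    unfolding v_def h_def using u by (intro upper_gradient_zero_extension) (auto simp: B_def)
  then have "weak_upper_gradient1 \<mu> UNIV v h"
    by (rule upper_gradient_imp_weak_upper_gradient1[OF \<mu>])
  moreover define A where "A = (\<integral>\<^sup>+ y \<in> B'. e2ennreal \<bar>v y - ereal c\<bar> \<partial>?M)"
  moreover have "0 < R" using R by simp
  ultimately have "A / emeasure ?M B' \<le> ennreal (C\<^sub>P * R) *
      ((\<integral>\<^sup>+ y \<in> ball x\<^sub>0 (\<tau> * R). h y \<partial>?M) / emeasure ?M (ball x\<^sub>0 (\<tau> * R)))"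
    using P(1) by (simp add: weak_poincare11_def c_def B'_def em)
  \<comment> \<open>The dilation by \<open>\<tau>\<close> is removed: the numerator grows to the
    integral over the whole space, which is that of \<open>g\<close> over \<open>B\<close>, and the
    denominator shrinks to the measure of \<open>B'\<close>.\<close>
  also have "\<dots> \<le> ennreal (C\<^sub>P * R) * ((\<integral>\<^sup>+ y. h y \<partial>?M) / emeasure ?M B')"
  proof -
    have "R \<le> \<tau> * R" using \<open>0 < R\<close> P(3) by simp
    then have "emeasure ?M B' \<le> emeasure ?M (ball x\<^sub>0 (\<tau> * R))"
      by (intro emeasure_mono) (auto simp: B'_def)
    moreover have "(\<integral>\<^sup>+ y \<in> ball x\<^sub>0 (\<tau> * R). h y \<partial>?M) \<le> (\<integral>\<^sup>+ y. h y \<partial>?M)"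
      by (intro nn_integral_mono) (auto simp: indicator_def)
    ultimately show ?thesis
      using ball_pos[OF \<open>0 < R\<close>, of x\<^sub>0]
      by (intro mult_left_mono ennreal_divide_mono) (auto simp: B'_def)
  qed
  finally have "A / emeasure ?M B' * emeasure ?M B' \<le>
      ennreal (C\<^sub>P * R) * ((\<integral>\<^sup>+ y. h y \<partial>?M) / emeasure ?M B') * emeasure ?M B'"
    by (rule mult_right_mono) simp
  then have A: "A \<le> ennreal (C\<^sub>P * R) * (\<integral>\<^sup>+ x \<in> B. g x \<partial>?M)"
    using ball_pos[OF \<open>0 < R\<close>, of x\<^sub>0]
    by (simp add: ennreal_divide_times mult.assoc B'_def h_def)
  \<comment> \<open>On \<open>D\<close> the function \<open>v\<close> is 0, so the deviation from
    the mean \<open>c\<close> is exactly \<open>\<bar>c\<bar>\<close> there.\<close>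
  have "ennreal \<bar>c\<bar> * emeasure ?M D = (\<integral>\<^sup>+ y \<in> D. ennreal \<bar>c\<bar> \<partial>?M)"
    by (simp add: nn_integral_cmult_indicator)
  also have "\<dots> \<le> A"
    unfolding A_def using \<open>D \<subseteq> B'\<close> z(2)
    by (intro nn_integral_mono) (auto simp: indicator_def v_def D_def)
  finally have cD: "ennreal \<bar>c\<bar> * emeasure ?M D \<le> A" .
  have "emeasure ?M B' \<le> emeasure ?M (ball z (2 ^ k * \<rho>))"
    using \<open>B' \<subseteq> _\<close> by (intro emeasure_mono) auto
  also have "\<dots> \<le> ennreal C\<^sub>D ^ k * emeasure ?M D"
    using doubling_power[OF dbl z(1), of z k] by (simp add: em D_def)
  finally have B'D: "emeasure ?M B' \<le> ennreal C\<^sub>D ^ k * emeasure ?M D" .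
  have "(\<integral>\<^sup>+ x \<in> B. e2ennreal \<bar>u x\<bar> \<partial>?M)
      \<le> (\<integral>\<^sup>+ x. e2ennreal \<bar>v x - ereal c\<bar> * indicator B' x + ennreal \<bar>c\<bar> * indicator B' x \<partial>?M)"
  proof (rule nn_integral_mono)
    fix x
    have "e2ennreal \<bar>u x\<bar> \<le> e2ennreal \<bar>u x - ereal c\<bar> + ennreal \<bar>c\<bar>"
      by (cases "u x") (auto simp flip: ennreal_plus intro!: ennreal_leI)
    then show "e2ennreal \<bar>u x\<bar> * indicator B x
      \<le> e2ennreal \<bar>v x - ereal c\<bar> * indicator B' x + ennreal \<bar>c\<bar> * indicator B' x"
      using \<open>B \<subseteq> B'\<close> by (auto simp: v_def indicator_def)
  qed
  also have "\<dots> = A + ennreal \<bar>c\<bar> * emeasure ?M B'"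
    unfolding A_def by (subst nn_integral_add) (auto simp: nn_integral_cmult_indicator)
  also have "\<dots> \<le> A + ennreal \<bar>c\<bar> * (ennreal C\<^sub>D ^ k * emeasure ?M D)"
    using B'D by (intro add_left_mono mult_left_mono) auto
  also have "\<dots> \<le> A + ennreal C\<^sub>D ^ k * A"
    using mult_left_mono[OF cD, of "ennreal C\<^sub>D ^ k"] by (simp add: ac_simps add_left_mono)
  also have "\<dots> = (1 + ennreal C\<^sub>D ^ k) * A" by (simp add: distrib_right)
  also have "\<dots> \<le> (1 + ennreal C\<^sub>D ^ k) * (ennreal (C\<^sub>P * R) * (\<integral>\<^sup>+ x \<in> B. g x \<partial>?M))"
    by (intro mult_left_mono A) simp
  finally show ?thesis by (simp add: mult.assoc)
qed

section \<open>Comparison of the capacities\<close>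

text \<open>Division by \<open>c\<close> reduces the claim to the greatest lower bound property. An
  empty \<open>I\<close> is covered, as then the right-hand side is infinite; this is the case
  without admissible functions.\<close>

lemma le_mult_INF_ennreal:
  fixes a c :: ennreal
  assumes "c \<noteq> 0" "c \<noteq> top" "\<And>i. i \<in> I \<Longrightarrow> a \<le> c * f i"
  shows "a \<le> c * (INF i\<in>I. f i)"
proof -
  have "a / c \<le> (INF i\<in>I. f i)"
    using assms by (intro INF_greatest divide_le_posI_ennreal) (auto simp: zero_less_iff_neq_zero mult.commute)
  then have "c * (a / c) \<le> c * (INF i\<in>I. f i)" by (rule mult_left_mono) simp
  then show ?thesis
    using assms(1,2) by (simp add: ennreal_times_divide mult_divide_eq_ennreal mult.commute)
qed

theorem lemma5p1:
  fixes x\<^sub>0 :: "'a::complete_space" and r C\<^sub>D C\<^sub>P \<tau> :: real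
  assumes "0 < r" and "UNIV - closure (ball x\<^sub>0 r) \<noteq> {}"
    and "0 < C\<^sub>P" and "1 \<le> \<tau>"
  shows "\<exists>C\<ge>1. \<forall>\<mu> :: 'a set \<Rightarrow> ennreal.
           borel_regular_outer_measure \<mu> \<longrightarrow> doubling C\<^sub>D \<mu> \<longrightarrow> weak_poincare11 C\<^sub>P \<tau> \<mu> \<longrightarrow>
           (\<forall>E \<subseteq> ball x\<^sub>0 r.
              comparable C (var_cap1 \<mu> E (ball x\<^sub>0 r)) (Sobolev_cap1 \<mu> E (ball x\<^sub>0 r)))"
proof -
  let ?B = "ball x\<^sub>0 r"
  obtain z where "z \<in> - closure ?B" using assms(2) by blast
  then obtain \<rho> where "0 < \<rho>" "ball z \<rho> \<subseteq> - closure ?B"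
    using open_contains_ball by (metis closed_closure open_Compl)
  then have z: "0 < \<rho>" "ball z \<rho> \<inter> ?B = {}" using closure_subset[of ?B] by auto
  \<comment> \<open>All constants from here to \<open>C\<close> are fixed before
    \<open>\<mu>\<close>, from the ball, \<open>C\<^sub>D\<close> and \<open>C\<^sub>P\<close>
    alone, so \<open>C\<close> is uniform in \<open>\<mu>\<close> and \<open>E\<close>.\<close>
  define R where "R = dist x\<^sub>0 z + \<rho> + r"
  obtain k where "2 * R / \<rho> < 2 ^ k" using real_arch_pow[of 2 "2 * R / \<rho>"] by auto
  then have k: "2 * R \<le> 2 ^ k * \<rho>" using z(1) by (simp add: field_simps)
  define K where "K = (1 + ennreal C\<^sub>D ^ k) * ennreal (C\<^sub>P * R)"
  \<comment> \<open>The summand 1 accounts for the gradient term of \<open>Sobolev_cap1\<close>, and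
    \<open>K\<close> for the term with \<open>u\<close>.\<close>
  define C where "C = 1 + enn2real K"
  have "K < top" by (auto simp: K_def ennreal_mult_less_top power_less_top_ennreal)
  then have C: "ennreal C = 1 + K" "1 \<le> C" by (simp_all add: C_def ennreal_plus)
  have "comparable C (var_cap1 \<mu> E ?B) (Sobolev_cap1 \<mu> E ?B)"
    if \<mu>: "borel_regular_outer_measure \<mu>" and dbl: "doubling C\<^sub>D \<mu>"
      and P: "weak_poincare11 C\<^sub>P \<tau> \<mu>" for \<mu> E
    unfolding comparable_def
  proof
    let ?M = "caratheodory \<mu>"
    have "ennreal (1 / C) * var_cap1 \<mu> E ?B \<le> 1 * var_cap1 \<mu> E ?B"
      using C(2) by (intro mult_right_mono) auto
    also have "\<dots> \<le> Sobolev_cap1 \<mu> E ?B"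
      unfolding var_cap1_def Sobolev_cap1_def mult_1
      \<comment> \<open>Both infima run over the same pairs, and adding the absolute value of
        \<open>u\<close> only enlarges the integrand.\<close>
      by (intro INF_mono') (auto intro!: nn_integral_mono mult_right_mono)
    finally show "ennreal (1 / C) * var_cap1 \<mu> E ?B \<le> Sobolev_cap1 \<mu> E ?B" .
    show "Sobolev_cap1 \<mu> E ?B \<le> ennreal C * var_cap1 \<mu> E ?B"
      unfolding var_cap1_def
    proof (rule le_mult_INF_ennreal)
      fix p assume p: "p \<in> admissible \<mu> E ?B"
      obtain u g where ug: "p = (u, g)" by (metis surj_pair)
      have adm: "u \<in> N11 \<mu> ?B" "upper_gradient ?B u g" "closure {x \<in> ?B. u x \<noteq> 0} \<subseteq> ?B"
        using p by (auto simp: admissible_def ug)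
      have [measurable]: "?B \<in> sets ?M"
        using sets_borel_subset_caratheodory[OF \<mu>] by auto
      \<comment> \<open>Both cut-off integrands are measurable on the whole space, as splitting the
        integral of the sum requires.\<close>
      have "(\<lambda>x. g x * indicator ?B x) \<in> borel_measurable borel"
        using adm(2) by (subst borel_measurable_restrict_space_iff_ennreal[symmetric])
          (auto simp: upper_gradient_def)
      then have g: "(\<lambda>x. g x * indicator ?B x) \<in> borel_measurable ?M"
        by (rule borel_measurable_caratheodory[OF \<mu>])
      have "(\<lambda>x. e2ennreal \<bar>u x\<bar>) \<in> borel_measurable (restrict_space ?M ?B)"
        using adm(1) by (auto simp: N11_def)
      then have u: "(\<lambda>x. e2ennreal \<bar>u x\<bar> * indicator ?B x) \<in> borel_measurable ?M"
        by (subst borel_measurable_restrict_space_iff_ennreal[symmetric]) auto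
      have "Sobolev_cap1 \<mu> E ?B \<le> (\<integral>\<^sup>+ x \<in> ?B. (e2ennreal \<bar>u x\<bar> + g x) \<partial>?M)"
        unfolding Sobolev_cap1_def using p by (intro INF_lower2[of p]) (auto simp: ug)
      also have "\<dots> = (\<integral>\<^sup>+ x \<in> ?B. e2ennreal \<bar>u x\<bar> \<partial>?M) + (\<integral>\<^sup>+ x \<in> ?B. g x \<partial>?M)"
        by (simp add: distrib_right nn_integral_add[OF u g])
      also have "\<dots> \<le> K * (\<integral>\<^sup>+ x \<in> ?B. g x \<partial>?M) + (\<integral>\<^sup>+ x \<in> ?B. g x \<partial>?M)"
        unfolding K_def using assms z k adm
        by (intro add_right_mono friedrichs_inequality[OF \<mu> dbl P]) (auto simp: R_def)
      also have "\<dots> = ennreal C * (\<integral>\<^sup>+ x \<in> ?B. g x \<partial>?M)"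
        by (simp add: C distrib_right add.commute)
      finally show "Sobolev_cap1 \<mu> E ?B \<le> ennreal C * (case p of (u, g) \<Rightarrow> \<integral>\<^sup>+ x \<in> ?B. g x \<partial>?M)"
        by (simp add: ug)
    qed (use C in auto)
  qed
  then show ?thesis using C(2) by auto
qed

end
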